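(* Let $\mathcal{S}$ be a finite set of scenarios with $|\mathcal{S}|\ge 2$. Let the decision set $\mathcal{D}$ be an interval $[x_a,x_b]$ of the real line, where $x_a=-\infty$ and/or $x_b=\infty$ is allowed, and for each $i\in\mathcal{S}$ let $f_i:\mathcal{D}\to\mathbb{R}$ be a strictly convex cost function. For each $i\in\mathcal{S}$ let $x^*_i$ be the (unique) minimiser of $f_i$ over $\mathcal{D}$ and let $\hat f_i(x)=f_i(x)-f_i(x^*_i)$ be the regret function. For each nonempty $\mathcal{S}'\subseteq\mathcal{S}$ let $\hat f_{\mathcal{S}'}(x)=\max_{i\in\mathcal{S}'}\hat f_i(x)$ and let $\hat x_{\mathcal{S}'}$ be the (unique) minimiser of $\hat f_{\mathcal{S}'}$ over $\mathcal{D}$; all these minimisers are assumed to exist. Write $\hat f_{kl}=\hat f_{\{k,l\}}$ and $\hat x_{kl}=\hat x_{\{k,l\}}$. Then there always exist two (distinct) scenarios $k,l\in\mathcal{S}$ such that $$\hat f_i(\hat x_{kl})\le \hat f_{kl}(\hat x_{kl})\quad\text{for all } i\in\mathcal{S}.$$ In particular, for such $k,l$, $\hat x_{\mathcal{S}}=\hat x_{kl}$, and indeed $\hat x_{\mathcal{S}'}=\hat x_{kl}$ for every subset $\mathcal{S}'$ of $\mathcal{S}$ which contains both $k$ and $l$.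
   Context: A decision problem consists of a finite set $\mathcal{S}$ of scenarios, a set $\mathcal{D}$ of possible decisions, and for each scenario $i\in\mathcal{S}$ a real-valued cost function $f_i$ on $\mathcal{D}$. The regret function $\hat f_i$ of scenario $i$ is $f_i$ minus its minimum value over $\mathcal{D}$. The least worst regret (LWR) solution $\hat x_{\mathcal{S}'}$ associated with a nonempty subset $\mathcal{S}'\subseteq\mathcal{S}$ is the value of $x\in\mathcal{D}$ which minimises the worst regret function $\hat f_{\mathcal{S}'}(x)=\max_{i\in\mathcal{S}'}\hat f_i(x)$; strict convexity makes it unique. When $x_a=-\infty$ or $x_b=\infty$, $\mathcal{D}$ denotes the set of real numbers $x$ with $x_a\le x\le x_b$. *)

theory Defs
  imports "HOL-Analysis.Analysis"
begin

definition strictly_convex_on :: "'a::real_vector set \<Rightarrow> ('a \<Rightarrow> real) \<Rightarrow> bool"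
  where "strictly_convex_on D f \<longleftrightarrow> convex D \<and>
    (\<forall>x\<in>D. \<forall>y\<in>D. x \<noteq> y \<longrightarrow>
      (\<forall>u>0. \<forall>v>0. u + v = 1 \<longrightarrow> f (u *\<^sub>R x + v *\<^sub>R y) < u * f x + v * f y))"

(* Cost functions are total on the reals, but only their values on the decision set D matter. *)

definition regret :: "real set \<Rightarrow> ('s \<Rightarrow> real \<Rightarrow> real) \<Rightarrow> 's \<Rightarrow> real \<Rightarrow> real"
  where "regret D f i x = f i x - f i (arg_min_on (f i) D)"

definition worst_regret :: "real set \<Rightarrow> ('s \<Rightarrow> real \<Rightarrow> real) \<Rightarrow> 's set \<Rightarrow> real \<Rightarrow> real"
  where "worst_regret D f T x = Max ((\<lambda>i. regret D f i x) ` T)"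

(* arg_min_on is based on choice: it returns a minimiser only if one exists. Existence is an
   explicit hypothesis wherever this is used; uniqueness is lwr_unique below. *)

definition lwr :: "real set \<Rightarrow> ('s \<Rightarrow> real \<Rightarrow> real) \<Rightarrow> 's set \<Rightarrow> real"
  where "lwr D f T = arg_min_on (worst_regret D f T) D"

lemma strictly_convex_on_arg_min_unique:
  fixes f :: "'a::real_vector \<Rightarrow> real"
  assumes "strictly_convex_on D f"
    and x: "is_arg_min f (\<lambda>z. z \<in> D) x" and y: "is_arg_min f (\<lambda>z. z \<in> D) y"
  shows "x = y"
proof (rule ccontr)
  assume ne: "x \<noteq> y"
  let ?z = "(1/2) *\<^sub>R x + (1/2) *\<^sub>R y"
  have xy: "x \<in> D" "y \<in> D" "f x \<le> f y" "f y \<le> f x"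
    using x y by (auto simp: is_arg_min_linorder)
  have "?z \<in> D"
    using assms(1) xy unfolding strictly_convex_on_def by (intro convexD) auto
  then have "f x \<le> f ?z"
    using x by (auto simp: is_arg_min_linorder)
  moreover have "f ?z < (1/2) * f x + (1/2) * f y"
  proof -
    have "\<forall>u>0. \<forall>v>0. u + v = 1 \<longrightarrow> f (u *\<^sub>R x + v *\<^sub>R y) < u * f x + v * f y"
      using assms(1) xy ne unfolding strictly_convex_on_def by blast
    from this[rule_format, of "1/2" "1/2"] show ?thesis
      by simp
  qed
  ultimately show False
    using xy by linarith
qed

lemma strictly_convex_on_worst_regret:
  assumes T: "finite T" "T \<noteq> {}" and sc: "\<And>i. i \<in> T \<Longrightarrow> strictly_convex_on D (f i)"
  shows "strictly_convex_on D (worst_regret D f T)"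
  unfolding strictly_convex_on_def
proof (intro conjI ballI impI allI)
  show "convex D"
    using T sc unfolding strictly_convex_on_def by blast
next
  fix x y u v :: real
  assume A: "x \<in> D" "y \<in> D" "x \<noteq> y" "u > 0" "v > 0" "u + v = 1"
  let ?z = "u *\<^sub>R x + v *\<^sub>R y"
  have ub: "regret D f i w \<le> worst_regret D f T w" if "i \<in> T" for i w
    unfolding worst_regret_def using T that by (intro Max_ge) auto
  have "Max ((\<lambda>i. regret D f i ?z) ` T) \<in> (\<lambda>i. regret D f i ?z) ` T"
    using T by (intro Max_in) auto
  then obtain i where i: "i \<in> T" "worst_regret D f T ?z = regret D f i ?z"
    unfolding worst_regret_def by auto
  define c where "c = f i (arg_min_on (f i) D)"
  have "f i ?z < u * f i x + v * f i y"
    using sc[OF i(1)] A unfolding strictly_convex_on_def by blast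
  moreover have "u * c + v * c = c"
    using A by (simp flip: distrib_right)
  ultimately have "regret D f i ?z < u * regret D f i x + v * regret D f i y"
    by (simp add: regret_def c_def right_diff_distrib)
  also have "\<dots> \<le> u * worst_regret D f T x + v * worst_regret D f T y"
    using A ub[OF i(1)] by (intro add_mono mult_left_mono) auto
  finally show "worst_regret D f T ?z < u * worst_regret D f T x + v * worst_regret D f T y"
    using i by simp
qed

lemma lwr_unique:
  assumes "finite T" "T \<noteq> {}" "\<And>i. i \<in> T \<Longrightarrow> strictly_convex_on D (f i)"
    and x: "is_arg_min (worst_regret D f T) (\<lambda>z. z \<in> D) x"
  shows "x = lwr D f T"
proof (rule strictly_convex_on_arg_min_unique[OF strictly_convex_on_worst_regret x])
  show "is_arg_min (worst_regret D f T) (\<lambda>z. z \<in> D) (lwr D f T)"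
    unfolding lwr_def arg_min_on_def arg_min_def using x by (rule someI)
qed (use assms in auto)

end

theory Submission
  imports Defs
begin

text \<open>
  The sublevel sets of a convex function on a real interval are intervals, and by Helly's theorem
  in dimension one, finitely many intervals that meet pairwise have a common point. Choose distinct
  scenarios \<open>k\<close> and \<open>l\<close> whose least worst regret \<open>w\<close> is the largest among all pairs. Then the
  sublevel sets at height \<open>w\<close> of the regrets of any two scenarios meet, at the LWR solution of that
  pair, so that some \<open>p\<close> has regret at most \<open>w\<close> in every scenario. As \<open>w\<close> is the least worst regret
  of \<open>{k, l}\<close>, the point \<open>p\<close> attains it, and by strict convexity \<open>p\<close> is the LWR solution of
  \<open>{k, l}\<close>. This is the existence claim.

  The second claim is that of an inactive constraint: enlarging \<open>{k, l}\<close> can only raise the worst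
  regret everywhere, and it does not raise it at the LWR solution of \<open>{k, l}\<close>, which therefore
  remains the minimiser.
\<close>

text \<open>
  Members with different indices may coincide as sets. If all of them do, Helly's theorem for a
  set of sets says nothing, and the common point comes from the case \<open>i = j\<close> of the hypothesis,
  which makes every member nonempty.
\<close>

lemma helly_real_indexed:
  fixes A :: "'i \<Rightarrow> real set"
  assumes fin: "finite I"
    and conv: "\<And>i. i \<in> I \<Longrightarrow> convex (A i)"
    and meet: "\<And>i j. i \<in> I \<Longrightarrow> j \<in> I \<Longrightarrow> A i \<inter> A j \<noteq> {}"
  shows "\<Inter> (A ` I) \<noteq> {}"
proof (cases "card (A ` I) \<ge> 2")
  case True
  show ?thesis
  proof (rule Helly)
    show "card (A ` I) \<ge> DIM(real) + 1"
      using True by simp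
    show "\<forall>B\<in>A ` I. convex B"
      using conv by blast
    show "\<Inter> F \<noteq> {}" if F: "F \<subseteq> A ` I" "card F = DIM(real) + 1" for F
    proof -
      have "card F = 2"
        using F(2) by simp
      then obtain B C where BC: "F = {B, C}"
        unfolding card_2_iff by blast
      then have "B \<in> A ` I" "C \<in> A ` I"
        using F(1) by simp_all
      then obtain i j where ij: "i \<in> I" "j \<in> I" "B = A i" "C = A j"
        by (elim imageE)
      then show ?thesis
        using BC meet[OF ij(1,2)] by simp
    qed
  qed
next
  case False
  show ?thesis
  proof (cases "I = {}")
    case False
    then obtain i where i: "i \<in> I"
      by blast
    have "card (A ` I) \<le> Suc 0"
      using \<open>\<not> card (A ` I) \<ge> 2\<close> by linarith
    then have "\<forall>B\<in>A ` I. \<forall>C\<in>A ` I. B = C"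
      using fin by (simp only: card_le_Suc0_iff_eq finite_imageI)
    then have "A j = A i" if "j \<in> I" for j
      using i that by blast
    then have "\<Inter> (A ` I) = A i"
      using i by blast
    then show ?thesis
      using meet[OF i i] by simp
  qed simp
qed

lemma strictly_convex_on_imp_convex_on:
  assumes "strictly_convex_on D f"
  shows "convex_on D f"
  unfolding convex_on_def
proof (intro conjI ballI allI impI)
  show "convex D"
    using assms by (simp add: strictly_convex_on_def)
  fix x y and u v :: real
  assume xy: "x \<in> D" "y \<in> D" and uv: "0 \<le> u" "0 \<le> v" "u + v = 1"
  show "f (u *\<^sub>R x + v *\<^sub>R y) \<le> u * f x + v * f y"
  proof (cases "x \<noteq> y \<and> u > 0 \<and> v > 0")
    case True
    then have "f (u *\<^sub>R x + v *\<^sub>R y) < u * f x + v * f y"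
      using assms xy uv unfolding strictly_convex_on_def by blast
    then show ?thesis
      by simp
  next
    case False
    then consider "x = y" | "u = 0" "v = 1" | "u = 1" "v = 0"
      using uv by fastforce
    then show ?thesis
    proof cases
      case 1
      have "u *\<^sub>R y + v *\<^sub>R y = y" "u * f y + v * f y = f y"
        using uv(3) by (metis scaleR_left_distrib scaleR_one, metis distrib_right mult_1)
      then show ?thesis
        using 1 by simp
    qed simp_all
  qed
qed

lemma convex_on_imp_convex_sublevel:
  assumes "convex_on D f"
  shows "convex {x \<in> D. f x \<le> c}"
proof (rule convexI)
  fix x y and u v :: real
  assume xy: "x \<in> {x \<in> D. f x \<le> c}" "y \<in> {x \<in> D. f x \<le> c}"
    and uv: "0 \<le> u" "0 \<le> v" "u + v = 1"
  have "u *\<^sub>R x + v *\<^sub>R y \<in> D"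
    using assms xy uv unfolding convex_on_def by (intro convexD) auto
  moreover have "f (u *\<^sub>R x + v *\<^sub>R y) \<le> max (f x) (f y)"
    using xy uv by (intro convex_lower[OF assms]) auto
  ultimately show "u *\<^sub>R x + v *\<^sub>R y \<in> {x \<in> D. f x \<le> c}"
    using xy by auto
qed

lemma worst_regret_le_iff:
  assumes "finite T" "T \<noteq> {}"
  shows "worst_regret D f T x \<le> c \<longleftrightarrow> (\<forall>i\<in>T. regret D f i x \<le> c)"
  unfolding worst_regret_def using assms by simp

lemma worst_regret_mono:
  assumes "finite T" "U \<subseteq> T" "U \<noteq> {}"
  shows "worst_regret D f U x \<le> worst_regret D f T x"
  unfolding worst_regret_def using assms by (intro Max_mono) auto

lemma is_arg_min_lwr:
  assumes "\<exists>x. is_arg_min (worst_regret D f T) (\<lambda>z. z \<in> D) x"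
  shows "is_arg_min (worst_regret D f T) (\<lambda>z. z \<in> D) (lwr D f T)"
  using assms unfolding lwr_def arg_min_on_def arg_min_def by (rule someI_ex)

text \<open>
  The largest least worst regret of a pair is the lowest height at which the sublevel sets of the
  regrets meet pairwise. By Helly's theorem they then have a common point, which can only be the
  LWR solution of the pair that attains this height.
\<close>

lemma exists_dominating_pair:
  fixes f :: "'s \<Rightarrow> real \<Rightarrow> real" and D :: "real set"
  assumes S: "finite S" "card S \<ge> 2"
    and sc: "\<And>i. i \<in> S \<Longrightarrow> strictly_convex_on D (f i)"
    and ex: "\<And>k l. k \<in> S \<Longrightarrow> l \<in> S \<Longrightarrow>
      \<exists>x. is_arg_min (worst_regret D f {k, l}) (\<lambda>z. z \<in> D) x"
  shows "\<exists>k\<in>S. \<exists>l\<in>S. k \<noteq> l \<and>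
    (\<forall>i\<in>S. regret D f i (lwr D f {k, l}) \<le> worst_regret D f {k, l} (lwr D f {k, l}))"
proof -
  define val where "val k l = worst_regret D f {k, l} (lwr D f {k, l})" for k l
  define P where "P = {(k, l). k \<in> S \<and> l \<in> S \<and> k \<noteq> l}"
  have "finite P"
    by (rule finite_subset[of _ "S \<times> S"]) (use S in \<open>auto simp: P_def\<close>)
  moreover have "P \<noteq> {}"
  proof -
    have "\<not> card S \<le> Suc 0"
      using S by simp
    then show ?thesis
      using S by (auto simp: P_def card_le_Suc0_iff_eq)
  qed
  ultimately have "Max (case_prod val ` P) \<in> case_prod val ` P"
    by (intro Max_in) auto
  then obtain k l where "(k, l) \<in> P" and max: "Max (case_prod val ` P) = val k l"
    by auto
  then have kl: "k \<in> S" "l \<in> S" "k \<noteq> l"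
    by (simp_all add: P_def)
  have largest: "val i j \<le> val k l" if "i \<in> S" "j \<in> S" "i \<noteq> j" for i j
  proof -
    have "case_prod val (i, j) \<le> Max (case_prod val ` P)"
      using \<open>finite P\<close> that by (intro Max_ge imageI finite_imageI) (simp_all add: P_def)
    then show ?thesis
      by (simp add: max)
  qed

  define A where "A i = {x \<in> D. regret D f i x \<le> val k l}" for i
  have pair: "A i \<inter> A j \<noteq> {}" if ij: "i \<in> S" "j \<in> S" "i \<noteq> j" for i j
  proof -
    have "lwr D f {i, j} \<in> D"
      using is_arg_min_lwr[OF ex[OF ij(1,2)]] by (simp add: is_arg_min_def)
    moreover have "worst_regret D f {i, j} (lwr D f {i, j}) \<le> val k l"
      using largest[OF ij] by (simp add: val_def)
    ultimately have "lwr D f {i, j} \<in> A i \<inter> A j"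
      by (simp add: A_def worst_regret_le_iff)
    then show ?thesis
      by blast
  qed
  have "\<Inter> (A ` S) \<noteq> {}"
  proof (rule helly_real_indexed[OF S(1)])
    show "convex (A i)" if "i \<in> S" for i
      using convex_on_imp_convex_sublevel[OF strictly_convex_on_imp_convex_on[OF sc[OF that]]]
      by (simp add: A_def regret_def diff_le_eq)
    show "A i \<inter> A j \<noteq> {}" if "i \<in> S" "j \<in> S" for i j
    proof (cases "i = j")
      case True
      \<comment> \<open>Nonemptiness of \<open>A i\<close> comes from pairing \<open>i\<close> with whichever of \<open>k\<close>, \<open>l\<close> differs from it.\<close>
      then show ?thesis
        using pair[of i k] pair[of i l] kl that by auto
    qed (use pair that in blast)
  qed
  then obtain p where p: "\<And>i. i \<in> S \<Longrightarrow> p \<in> A i"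
    by blast

  have "is_arg_min (worst_regret D f {k, l}) (\<lambda>z. z \<in> D) p"
  proof -
    have "p \<in> D" "worst_regret D f {k, l} p \<le> val k l"
      using p kl by (auto simp: A_def worst_regret_le_iff)
    then show ?thesis
      using is_arg_min_lwr[OF ex[OF kl(1,2)]] unfolding is_arg_min_linorder val_def
      by (meson order_trans)
  qed
  then have p_eq: "p = lwr D f {k, l}"
    by (intro lwr_unique) (use sc kl in auto)
  have "regret D f i (lwr D f {k, l}) \<le> worst_regret D f {k, l} (lwr D f {k, l})"
    if "i \<in> S" for i
    using p[OF that] unfolding A_def val_def p_eq by simp
  then show ?thesis
    using kl by blast
qed

text \<open>
  Scenarios in \<open>T\<close> that do not exceed the worst regret of \<open>U\<close> at the LWR solution of \<open>U\<close> are
  inactive there, so they cannot move the minimiser.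
\<close>

lemma lwr_superset_eq:
  assumes T: "finite T" "U \<subseteq> T" "U \<noteq> {}"
    and sc: "\<And>i. i \<in> T \<Longrightarrow> strictly_convex_on D (f i)"
    and ex: "\<exists>x. is_arg_min (worst_regret D f U) (\<lambda>z. z \<in> D) x"
    and dom: "\<And>i. i \<in> T \<Longrightarrow> regret D f i (lwr D f U) \<le> worst_regret D f U (lwr D f U)"
  shows "lwr D f T = lwr D f U"
proof -
  have ne: "T \<noteq> {}"
    using T by blast
  have U: "lwr D f U \<in> D" "\<And>y. y \<in> D \<Longrightarrow> worst_regret D f U (lwr D f U) \<le> worst_regret D f U y"
    using is_arg_min_lwr[OF ex] by (auto simp: is_arg_min_linorder)
  have "worst_regret D f T (lwr D f U) \<le> worst_regret D f T y" if "y \<in> D" for y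
  proof -
    have "worst_regret D f T (lwr D f U) \<le> worst_regret D f U (lwr D f U)"
      using T ne dom by (simp add: worst_regret_le_iff)
    also have "\<dots> \<le> worst_regret D f U y"
      by (rule U(2)[OF that])
    also have "\<dots> \<le> worst_regret D f T y"
      by (rule worst_regret_mono[OF T])
    finally show ?thesis .
  qed
  then have "is_arg_min (worst_regret D f T) (\<lambda>z. z \<in> D) (lwr D f U)"
    using U(1) by (simp add: is_arg_min_linorder)
  from lwr_unique[OF T(1) ne sc this] show ?thesis
    by simp
qed

theorem proposition2:
  fixes S :: "'s set" and f :: "'s \<Rightarrow> real \<Rightarrow> real"
    and D :: "real set" and xa xb :: ereal
  assumes "finite S" and "card S \<ge> 2"
    and "xa \<noteq> \<infinity>" and "xb \<noteq> -\<infinity>" and "xa \<le> xb"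
    and "D = {x. xa \<le> ereal x \<and> ereal x \<le> xb}"
    and "\<And>i. i \<in> S \<Longrightarrow> strictly_convex_on D (f i)"
    and "\<And>i. i \<in> S \<Longrightarrow> \<exists>x. is_arg_min (f i) (\<lambda>z. z \<in> D) x"
    and "\<And>T. T \<subseteq> S \<Longrightarrow> T \<noteq> {} \<Longrightarrow> \<exists>x. is_arg_min (worst_regret D f T) (\<lambda>z. z \<in> D) x"
  shows "(\<exists>k\<in>S. \<exists>l\<in>S. k \<noteq> l \<and>
            (\<forall>i\<in>S. regret D f i (lwr D f {k, l}) \<le> worst_regret D f {k, l} (lwr D f {k, l})))
       \<and> (\<forall>k\<in>S. \<forall>l\<in>S. k \<noteq> l \<longrightarrow>
            (\<forall>i\<in>S. regret D f i (lwr D f {k, l}) \<le> worst_regret D f {k, l} (lwr D f {k, l})) \<longrightarrow>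
            lwr D f S = lwr D f {k, l} \<and>
            (\<forall>T. T \<subseteq> S \<and> k \<in> T \<and> l \<in> T \<longrightarrow> lwr D f T = lwr D f {k, l}))"
proof (intro conjI ballI impI)
  show "\<exists>k\<in>S. \<exists>l\<in>S. k \<noteq> l \<and>
      (\<forall>i\<in>S. regret D f i (lwr D f {k, l}) \<le> worst_regret D f {k, l} (lwr D f {k, l}))"
    by (rule exists_dominating_pair[OF assms(1,2,7)]) (auto intro!: assms(9))
next
  fix k l
  assume kl: "k \<in> S" "l \<in> S"
    and dom: "\<forall>i\<in>S. regret D f i (lwr D f {k, l}) \<le> worst_regret D f {k, l} (lwr D f {k, l})"
  have eq: "lwr D f T = lwr D f {k, l}" if "T \<subseteq> S" "k \<in> T" "l \<in> T" for T
  proof (rule lwr_superset_eq)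
    show "finite T"
      using that(1) assms(1) by (rule finite_subset)
    show "\<exists>x. is_arg_min (worst_regret D f {k, l}) (\<lambda>z. z \<in> D) x"
      using kl by (intro assms(9)) auto
  qed (use that dom assms(7) in auto)
  show "lwr D f S = lwr D f {k, l}"
    using kl by (intro eq) auto
  show "\<forall>T. T \<subseteq> S \<and> k \<in> T \<and> l \<in> T \<longrightarrow> lwr D f T = lwr D f {k, l}"
    using eq by blast
qed

end
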